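(* The inequality $$\int_0^\infty f(t)\cos(xt)\,dt>0$$ holds for all $x>0$ when $f$ is a function on $(0,\infty)$ that is nonnegative, sectionally smooth, strictly decreasing and convex on its support, with $$\int_0^1 f(t)\,dt<\infty\quad\text{and}\quad \lim_{t\to\infty}f(t)=0.$$
   Context: A function $h$ is sectionally smooth on an interval if both $h$ and $h'$ are sectionally (that is, piecewise) continuous there. The integral over $(0,\infty)$ is an improper integral, possibly only conditionally convergent at infinity.
   Formalization: Adds that f is not identically zero, is continuous on (0,∞) (no jump at an end of its support) and is strictly convex on its support; without these the strict inequality fails, e.g. for f=0, for e^{-t/10} cut off at t=1 (x=3π/2), and for max(1-t,0) at x=2π. *)

theory Defs
  imports "HOL-Analysis.Analysis"
begin

(* Finitely many discontinuities in each compact subinterval of I, with finite one-sided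
   limits at all of its points.  For I = {0<..} nothing is required at 0 or at infinity,
   so h may be unbounded near 0.  The values of h at its discontinuities are irrelevant. *)
definition sectionally_continuous_on :: "real set \<Rightarrow> (real \<Rightarrow> real) \<Rightarrow> bool" where
  "sectionally_continuous_on I h \<longleftrightarrow>
     (\<forall>a b. a < b \<and> {a..b} \<subseteq> I \<longrightarrow>
        finite {t \<in> {a<..<b}. \<not> isCont h t} \<and>
        (\<forall>t\<in>{a..<b}. \<exists>l. (h \<longlongrightarrow> l) (at_right t)) \<and>
        (\<forall>t\<in>{a<..b}. \<exists>l. (h \<longlongrightarrow> l) (at_left t)))"

(* The term deriv h carries an arbitrary value where h is not differentiable; there are only
   finitely many such points in a compact subinterval, so these values do not matter. *)
definition sectionally_smooth_on :: "real set \<Rightarrow> (real \<Rightarrow> real) \<Rightarrow> bool" where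
  "sectionally_smooth_on I h \<longleftrightarrow>
     sectionally_continuous_on I h \<and>
     (\<forall>a b. a < b \<and> {a..b} \<subseteq> I \<longrightarrow> finite {t \<in> {a<..<b}. \<not> h differentiable (at t)}) \<and>
     sectionally_continuous_on I (deriv h)"

definition strictly_convex_on :: "real set \<Rightarrow> (real \<Rightarrow> real) \<Rightarrow> bool" where
  "strictly_convex_on S h \<longleftrightarrow>
     convex S \<and>
     (\<forall>s\<in>S. \<forall>t\<in>S. \<forall>u. s \<noteq> t \<and> 0 < u \<and> u < 1 \<longrightarrow>
        h ((1 - u) * s + u * t) < (1 - u) * h s + u * h t)"

(* Improper at infinity: no absolute integrability on the half-line is required.
   At 0 the Henstock-Kurzweil integral already includes the improper Riemann integral. *)
definition has_improper_integral :: "(real \<Rightarrow> real) \<Rightarrow> real \<Rightarrow> bool" where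
  "has_improper_integral g L \<longleftrightarrow>
     (\<forall>R>0. g integrable_on {0<..R}) \<and>
     ((\<lambda>R. integral {0<..R} g) \<longlongrightarrow> L) at_top"

end

theory Submission
  imports Defs
begin

text \<open>Each full period of the cosine is folded onto its first quarter. With \<open>c\<close> the left end of the
  period and \<open>q = pi / (2 * x)\<close> a quarter of its length, the integrand becomes
  \<open>cos (x * u)\<close> times \<open>f (c + u) - f (c + 2 * q - u) - f (c + 2 * q + u) + f (c + 4 * q - u)\<close>.
  The inner two points have the same midpoint as the outer two, so convexity makes this bracket
  nonnegative, and strict convexity makes it positive near the origin in the first period.
  Existence of the improper integral is Cauchy's criterion, with tails bounded by the second mean
  value theorem; its value is at least the integral over the first period.\<close>

section \<open>Estimates and substitutions for integrals\<close>

text \<open>The second mean value theorem leaves two integrals of the cosine alone, each at most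
  \<open>2 / x\<close> in modulus, with weights at most \<open>f a\<close>. The bound is free of
  \<open>b\<close>, so it controls tails.\<close>

lemma second_mean_value_cos_bound:
  fixes f :: "real \<Rightarrow> real"
  assumes "a \<le> b" "x > 0" and f: "antimono_on {a..b} f" and "f b \<ge> 0"
  shows "\<bar>integral {a..b} (\<lambda>t. f t * cos (x * t))\<bar> \<le> 4 * f a / x"
proof -
  have cos_int: "((\<lambda>t. cos (x * t)) has_integral (sin (x * d) - sin (x * c)) / x) {c..d}" if "c \<le> d" for c d
  proof -
    have "((\<lambda>t. cos (x * t)) has_integral sin (x * d) / x - sin (x * c) / x) {c..d}"
      using \<open>x > 0\<close> that
      by (intro fundamental_theorem_of_calculus)
         (auto intro!: derivative_eq_intros simp flip: has_real_derivative_iff_has_vector_derivative)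
    then show ?thesis
      by (simp add: diff_divide_distrib)
  qed
  have bound: "\<bar>integral {c..d} (\<lambda>t. cos (x * t))\<bar> \<le> 2 / x" if "c \<le> d" for c d
  proof -
    have "\<bar>sin (x * d) - sin (x * c)\<bar> \<le> 2"
      using sin_le_one[of "x * d"] sin_le_one[of "x * c"] sin_ge_minus_one[of "x * d"] sin_ge_minus_one[of "x * c"]
      by linarith
    then show ?thesis
      using \<open>x > 0\<close> by (simp add: integral_unique[OF cos_int[OF that]] abs_divide divide_right_mono)
  qed
  have cos_integrable: "(\<lambda>t. cos (x * t)) integrable_on {a..b}"
    using cos_int[OF \<open>a \<le> b\<close>] by blast
  \<comment> \<open>The mean value theorem is applied to an increasing function, hence to
    \<open>- f\<close>.\<close>
  have mono: "- f s \<le> - f t" if "a \<le> s" "s \<le> t" "t \<le> b" for s t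
    using monotone_onD[OF f, of s t] that by auto
  obtain c where c: "c \<in> {a..b}" and
    eq: "integral {a..b} (\<lambda>t. - f t * cos (x * t)) =
      - f a * integral {a..c} (\<lambda>t. cos (x * t)) + - f b * integral {c..b} (\<lambda>t. cos (x * t))"
    by (rule second_mean_value_theorem[where g = "\<lambda>t. - f t", OF cos_integrable \<open>a \<le> b\<close> mono])
  have "f b \<le> f a"
    using monotone_onD[OF f, of a b] \<open>a \<le> b\<close> by auto
  have "\<bar>integral {a..b} (\<lambda>t. f t * cos (x * t))\<bar>
      \<le> f a * \<bar>integral {a..c} (\<lambda>t. cos (x * t))\<bar> + f b * \<bar>integral {c..b} (\<lambda>t. cos (x * t))\<bar>"
    using eq abs_triangle_ineq[of "f a * integral {a..c} (\<lambda>t. cos (x * t))" "f b * integral {c..b} (\<lambda>t. cos (x * t))"]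
      \<open>f b \<ge> 0\<close> \<open>f b \<le> f a\<close> by (simp add: abs_mult)
  also have "\<dots> \<le> f a * (2 / x) + f a * (2 / x)"
    using c bound \<open>f b \<ge> 0\<close> \<open>f b \<le> f a\<close> by (intro add_mono mult_mono) auto
  finally show ?thesis
    by simp
qed

text \<open>The first and third quarters are translated, the second and fourth reflected. For a
  quarter period \<open>q\<close>, the four arguments then have cosines that agree up to
  sign.\<close>

lemma has_integral_fold_quarters:
  fixes h :: "real \<Rightarrow> real"
  assumes "h integrable_on {c..c + 4 * q}" "q \<ge> 0"
  shows "((\<lambda>u. h (c + u) + h (c + 2 * q - u) + h (c + 2 * q + u) + h (c + 4 * q - u))
    has_integral integral {c..c + 4 * q} h) {0..q}"
proof -
  have shift: "((\<lambda>u. h (d + u)) has_integral integral {d..d + q} h) {0..q}"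
    if "h integrable_on {d..d + q}" for d
    using has_integral_shift_Icc_real[of h d "integral {d..d + q} h" 0 q] integrable_integral[OF that]
    by (simp add: o_def add.commute)
  have reflect: "((\<lambda>u. h (d - u)) has_integral integral {d - q..d} h) {0..q}"
    if "h integrable_on {d - q..d}" for d
  proof -
    have "((\<lambda>u. h (d + u)) has_integral integral {d - q..d} h) {-q..0}"
      using has_integral_shift_Icc_real[of h d "integral {d - q..d} h" "-q" 0] integrable_integral[OF that]
      by (simp add: o_def add.commute)
    then show ?thesis
      using has_integral_reflect_real[of "\<lambda>u. h (d + u)" "integral {d - q..d} h" 0 "-q"] by simp
  qed
  have int: "h integrable_on {d..e}" if "c \<le> d" "e \<le> c + 4 * q" for d e
    using integrable_subinterval_real[OF assms(1), of d e] that by auto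
  have "integral {c..c + 4 * q} h = integral {c..c + q} h + integral {c + q..c + 2 * q} h
      + integral {c + 2 * q..c + 3 * q} h + integral {c + 3 * q..c + 4 * q} h"
    using Henstock_Kurzweil_Integration.integral_combine[of c "c + q" "c + 4 * q" h] Henstock_Kurzweil_Integration.integral_combine[of "c + q" "c + 2 * q" "c + 4 * q" h]
      Henstock_Kurzweil_Integration.integral_combine[of "c + 2 * q" "c + 3 * q" "c + 4 * q" h] int assms by auto
  moreover have "((\<lambda>u. h (c + u) + h (c + 2 * q - u) + h (c + 2 * q + u) + h (c + 4 * q - u))
    has_integral integral {c..c + q} h + integral {c + 2 * q - q..c + 2 * q} h
      + integral {c + 2 * q..c + 2 * q + q} h + integral {c + 4 * q - q..c + 4 * q} h) {0..q}"
    using \<open>q \<ge> 0\<close> by (intro has_integral_add shift reflect int) auto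
  ultimately show ?thesis
    by (simp add: algebra_simps)
qed

section \<open>Monotonicity and chord inequalities on the half-line\<close>

context
  fixes f :: "real \<Rightarrow> real"
  assumes nonneg: "\<And>t. t > 0 \<Longrightarrow> f t \<ge> 0"
    and cont: "continuous_on {0<..} f"
    and decr: "strict_antimono_on (support_on {0<..} f) f"
    and conv: "strictly_convex_on (support_on {0<..} f) f"
begin

lemma exists_value_between:
  assumes "0 < s" "s < t" "f s < y \<and> y < f t \<or> f t < y \<and> y < f s"
  shows "\<exists>r\<in>{s<..<t}. f r = y"
proof -
  have c: "continuous_on {s..t} f"
    using assms by (intro continuous_on_subset[OF cont]) auto
  obtain r where "s \<le> r" "r \<le> t" "f r = y"
    using assms IVT'[OF _ _ _ c, of y] IVT2'[OF _ _ _ c, of y] by force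
  then show ?thesis
    using assms by (intro bexI[of _ r]) (auto simp: less_le)
qed

text \<open>Decrease is assumed on the support only. A rise from \<open>s\<close> to
  \<open>t\<close> would take the mean of \<open>f s\<close> and \<open>f t\<close> at some
  \<open>r\<close> in between; this value is positive, so \<open>r\<close> and \<open>t\<close> are
  in the support and \<open>f t < f r\<close>, a contradiction.\<close>

lemma antimono_on_positive: "antimono_on {0<..} f"
proof (rule monotone_onI)
  fix s t :: real
  assume st: "s \<in> {0<..}" "t \<in> {0<..}" "s \<le> t"
  show "f t \<le> f s"
  proof (rule ccontr)
    assume "\<not> f t \<le> f s"
    then have less: "f s < f t" "s < t"
      using st by (auto simp: less_le)
    then have "f s < (f s + f t) / 2 \<and> (f s + f t) / 2 < f t"
      by simp
    then obtain r where r: "r \<in> {s<..<t}" "f r = (f s + f t) / 2"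
      using exists_value_between[of s t "(f s + f t) / 2"] st less by auto
    moreover have "f s \<ge> 0" "f t > 0"
      using nonneg[of s] st less by auto
    ultimately have "f t < f r"
      using st monotone_onD[OF decr, of r t] by (auto simp: in_support_on)
    then show False
      using r less by simp
  qed
qed

text \<open>Monotonicity makes \<open>f s\<close> positive too, so both ends lie in the support and
  strict convexity applies; the denominator \<open>t - s\<close> is cleared.\<close>

lemma support_chord:
  assumes "0 < s" "s < m" "m < t" "f t > 0"
  shows "f m * (t - s) < (t - m) * f s + (m - s) * f t"
proof -
  have "f s \<ge> f t"
    using assms monotone_onD[OF antimono_on_positive, of s t] by auto
  define u where "u = (m - s) / (t - s)"
  have u: "0 < u" "u < 1" "1 - u = (t - m) / (t - s)"
    using assms by (auto simp: u_def field_simps)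
  have "(1 - u) * s + u * t = ((t - m) * s + (m - s) * t) / (t - s)"
    by (simp add: u(3)) (simp add: u_def add_divide_distrib)
  also have "\<dots> = m"
    using assms by (simp add: field_simps)
  finally have m: "(1 - u) * s + u * t = m" .
  have "s \<in> support_on {0<..} f" "t \<in> support_on {0<..} f" "s \<noteq> t"
    using assms \<open>f s \<ge> f t\<close> by (auto simp: in_support_on)
  then have "f ((1 - u) * s + u * t) < (1 - u) * f s + u * f t"
    using conv u(1,2) unfolding strictly_convex_on_def by blast
  then have "f m < (1 - u) * f s + u * f t"
    by (simp only: m)
  also have "\<dots> = ((t - m) * f s + (m - s) * f t) / (t - s)"
    by (simp add: u(3)) (simp add: u_def add_divide_distrib)
  finally show ?thesis
    using assms by (simp add: field_simps)
qed

text \<open>Convexity is assumed on the support only, so \<open>f t = 0\<close> needs care. If also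
  \<open>f m = 0\<close>, the right side is positive because \<open>f s\<close> is; if
  \<open>f m > 0\<close>, continuity supplies support points beyond \<open>m\<close>.\<close>

lemma strict_chord:
  assumes "0 < s" "s < m" "m < t" "f s > 0"
  shows "f m * (t - s) < (t - m) * f s + (m - s) * f t"
proof -
  consider "f t > 0" | "f t = 0" "f m = 0" | "f t = 0" "f m > 0"
    using nonneg[of t] nonneg[of m] assms by fastforce
  then show ?thesis
  proof cases
    case 3
    \<comment> \<open>\<open>t\<close> is not in the support: it is replaced by points between \<open>r\<close> and \<open>t\<close> at which \<open>f\<close>
      takes arbitrarily small positive values.\<close>
    have weak: "f r * (t - s) \<le> (t - r) * f s" if r: "s < r" "r < t" "f r > 0" for r
    proof (rule field_le_epsilon)
      fix e :: real
      assume "e > 0"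
      \<comment> \<open>The first bound puts \<open>d\<close> strictly between
        \<open>f t = 0\<close> and \<open>f r\<close>; the second keeps the error term
        \<open>(r - s) * d\<close> below \<open>e\<close>.\<close>
      define d where "d = min (f r / 2) (e / (t - s))"
      have "0 < d" "d < f r" "d * (t - s) \<le> e"
        using r assms \<open>e > 0\<close> by (auto simp: d_def min_def field_simps)
      then obtain v where v: "r < v" "v < t" "f v = d"
        using exists_value_between[of r t d] r assms 3 by force
      have "f s \<ge> f r"
        using r assms monotone_onD[OF antimono_on_positive, of s r] by auto
      have "f r * (v - s) < (v - r) * f s + (r - s) * d"
        using support_chord[of s r v] v r assms \<open>0 < d\<close> by auto
      \<comment> \<open>Adding the missing length \<open>t - v\<close>, with the larger height
        \<open>f s\<close> on the right, replaces the end \<open>v\<close> by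
        \<open>t\<close>.\<close>
      moreover have "f r * (t - v) \<le> f s * (t - v)"
        using v \<open>f s \<ge> f r\<close> by (intro mult_right_mono) auto
      moreover have "(r - s) * d \<le> (t - s) * d"
        using r \<open>0 < d\<close> by (intro mult_right_mono) auto
      then have "(r - s) * d \<le> e"
        using \<open>d * (t - s) \<le> e\<close> by (simp add: mult.commute)
      ultimately show "f r * (t - s) \<le> (t - r) * f s + e"
        by (simp add: algebra_simps)
    qed
    \<comment> \<open>The limit loses strictness; passing through a further point \<open>v\<close> of the support restores it.\<close>
    obtain v where v: "m < v" "v < t" "f v > 0"
      using exists_value_between[of m t "f m / 2"] assms 3 by force
    have "f m * (v - s) < (v - m) * f s + (m - s) * f v"
      using support_chord[of s m v] v assms by simp
    then have "f m * (v - s) * (t - s) < ((v - m) * f s + (m - s) * f v) * (t - s)"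
      using assms by (intro mult_strict_right_mono) auto
    also have "\<dots> = (v - m) * f s * (t - s) + (m - s) * (f v * (t - s))"
      by (simp add: algebra_simps)
    also have "\<dots> \<le> (v - m) * f s * (t - s) + (m - s) * ((t - v) * f s)"
      using weak[of v] v assms 3 by (intro add_left_mono mult_left_mono) auto
    \<comment> \<open>This is
      \<open>(v - m) * (t - s) + (m - s) * (t - v) = (t - m) * (v - s)\<close>.\<close>
    also have "\<dots> = ((t - m) * f s) * (v - s)"
      by (simp add: algebra_simps)
    finally have "(f m * (t - s)) * (v - s) < ((t - m) * f s) * (v - s)"
      by (simp add: mult_ac)
    then show ?thesis
      using v assms 3 by (simp add: mult_less_cancel_right)
  qed (use support_chord assms in auto)
qed

text \<open>Both inner points lie below the outer chord. Their weights \<open>d\<close> and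
  \<open>d + e\<close> are interchanged, so in the sum each end has weight \<open>2 * d + e\<close>,
  which cancels.\<close>

lemma four_point:
  assumes "0 < a" "0 < d" "0 < e" "f a > 0"
  shows "f (a + d) + f (a + d + e) < f a + f (a + 2 * d + e)"
proof -
  have "f (a + d) * (2 * d + e) < (d + e) * f a + d * f (a + 2 * d + e)"
    using strict_chord[of a "a + d" "a + 2 * d + e"] assms by (simp add: algebra_simps)
  moreover have "f (a + d + e) * (2 * d + e) < d * f a + (d + e) * f (a + 2 * d + e)"
    using strict_chord[of a "a + d + e" "a + 2 * d + e"] assms by (simp add: algebra_simps)
  ultimately have "(f (a + d) + f (a + d + e)) * (2 * d + e) < (f a + f (a + 2 * d + e)) * (2 * d + e)"
    by (simp add: algebra_simps)
  then show ?thesis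
    using assms by (simp add: mult_less_cancel_right)
qed

text \<open>Where \<open>f a = 0\<close>, monotonicity makes the left side vanish; this covers
  periods beyond the support.\<close>

lemma four_point_weak:
  assumes "0 < a" "0 < d" "0 < e"
  shows "f (a + d) + f (a + d + e) \<le> f a + f (a + 2 * d + e)"
proof (cases "f a > 0")
  case True
  then show ?thesis
    using four_point assms by (simp add: less_imp_le)
next
  case False
  have "f (a + d) \<le> f a" "f (a + d + e) \<le> f a" "f (a + 2 * d + e) \<ge> 0"
    using assms nonneg monotone_onD[OF antimono_on_positive, of a "a + d"]
       monotone_onD[OF antimono_on_positive, of a "a + d + e"] by auto
  then show ?thesis
    using False by linarith
qed

section \<open>Sign of the integral over one period\<close>

context
  fixes x q :: real and h :: "real \<Rightarrow> real"
  assumes x: "x > 0"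
  defines "q \<equiv> pi / (2 * x)"
    and "h \<equiv> \<lambda>t. f t * cos (x * t)"
begin

lemma quarter_pos: "q > 0"
  using x by (simp add: q_def)

lemma cos_pos_quarter: "0 < u \<Longrightarrow> u < q \<Longrightarrow> 0 < cos (x * u)"
  using x by (intro cos_gt_zero) (auto simp: q_def field_simps)

text \<open>Modulo \<open>2 * pi\<close> the four phases are \<open>x * u\<close>,
  \<open>pi - x * u\<close>, \<open>pi + x * u\<close> and \<open>2 * pi - x * u\<close>, which
  gives the signs +, -, -, +.\<close>

lemma folded_integrand:
  fixes n :: nat
  shows "h (4 * q * n + u) + h (4 * q * n + 2 * q - u) + h (4 * q * n + 2 * q + u) + h (4 * q * n + 4 * q - u)
   = cos (x * u) * (f (4 * q * n + u) - f (4 * q * n + 2 * q - u)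
       - f (4 * q * n + 2 * q + u) + f (4 * q * n + 4 * q - u))"
proof -
  have per: "cos (2 * pi * n + y) = cos y" for y :: real
    using cos_int_2pin[of "int n"] sin_int_2pin[of "int n"] by (simp add: cos_add)
  have "x * (4 * q * n + u) = 2 * pi * n + x * u"
       "x * (4 * q * n + 2 * q - u) = 2 * pi * n + (pi - x * u)"
       "x * (4 * q * n + 2 * q + u) = 2 * pi * n + (pi + x * u)"
       "x * (4 * q * n + 4 * q - u) = 2 * pi * n + (2 * pi - x * u)"
    using x by (auto simp: q_def field_simps)
  then have "cos (x * (4 * q * n + u)) = cos (x * u)"
       "cos (x * (4 * q * n + 2 * q - u)) = - cos (x * u)"
       "cos (x * (4 * q * n + 2 * q + u)) = - cos (x * u)"
       "cos (x * (4 * q * n + 4 * q - u)) = cos (x * u)"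
    by (simp_all only: per) (simp_all add: cos_diff cos_add)
  then show ?thesis
    by (simp add: h_def algebra_simps)
qed

lemma folded_bracket_nonneg:
  fixes n :: nat
  assumes "0 < u" "u < q"
  shows "0 \<le> f (4 * q * n + u) - f (4 * q * n + 2 * q - u) - f (4 * q * n + 2 * q + u) + f (4 * q * n + 4 * q - u)"
proof -
  have "4 * q * n + u > 0"
    using assms quarter_pos by (intro add_nonneg_pos) auto
  \<comment> \<open>The gaps between the four points are \<open>2 * q - 2 * u\<close>,
    \<open>2 * u\<close> and again \<open>2 * q - 2 * u\<close>.\<close>
  then show ?thesis
    using four_point_weak[of "4 * q * n + u" "2 * q - 2 * u" "2 * u"] assms by (simp add: algebra_simps)
qed

lemma period_integral_nonneg:
  fixes n :: nat
  assumes "h integrable_on {4 * q * n..4 * q * n + 4 * q}"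
  shows "0 \<le> integral {4 * q * n..4 * q * n + 4 * q} h"
proof -
  \<comment> \<open>The interval is open because \<open>f 0\<close> is arbitrary.\<close>
  have "((\<lambda>u. cos (x * u) * (f (4 * q * n + u) - f (4 * q * n + 2 * q - u)
       - f (4 * q * n + 2 * q + u) + f (4 * q * n + 4 * q - u)))
     has_integral integral {4 * q * n..4 * q * n + 4 * q} h) {0<..<q}"
    using has_integral_fold_quarters[OF assms] quarter_pos
    by (simp add: folded_integrand has_integral_Icc_iff_Ioo)
  then show ?thesis
    by (rule has_integral_nonneg) (use cos_pos_quarter folded_bracket_nonneg in \<open>force intro!: mult_nonneg_nonneg\<close>)
qed

lemma first_period_integral_pos:
  assumes "h integrable_on {0..4 * q}" and "support_on {0<..} f \<noteq> {}"
  shows "0 < integral {0..4 * q} h"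
proof -
  define G where "G = (\<lambda>u. cos (x * u) * (f u - f (2 * q - u) - f (2 * q + u) + f (4 * q - u)))"
  have G: "(G has_integral integral {0..4 * q} h) {0<..<q}"
    using has_integral_fold_quarters[of h 0 q] assms quarter_pos folded_integrand[where n=0]
    by (simp add: G_def has_integral_Icc_iff_Ioo)
  obtain b where b: "b > 0" "f b > 0"
    using assms(2) nonneg by (force simp: support_on_def less_le)
  \<comment> \<open>Below \<open>b\<close> the function is positive by monotonicity, and below
    \<open>q\<close> the cosine is; hence the folded integrand is strictly positive up to
    \<open>c\<close>.\<close>
  define c where "c = min b q / 2"
  have c: "0 < c" "c < b" "c < q"
    using b quarter_pos by (auto simp: c_def)
  have pos: "0 < G u" if "0 < u" "u \<le> c" for u
  proof -
    have "f u > 0"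
      using monotone_onD[OF antimono_on_positive, of u b] that b c by auto
    then show ?thesis
      using four_point[of u "2 * q - 2 * u" "2 * u"] cos_pos_quarter[of u] that c
      unfolding G_def by (intro mult_pos_pos) (auto simp: algebra_simps)
  qed
  \<comment> \<open>Starting at \<open>c/2\<close> avoids 0, near which \<open>f\<close> may be
    unbounded. As \<open>G\<close> is nonnegative on the whole quarter, this piece bounds the
    integral from below.\<close>
  have contG: "continuous_on {c/2..c} G"
    unfolding G_def using c
    by (intro continuous_intros continuous_on_compose2[OF cont]) auto
  have "0 < integral {c/2..c} G"
    using integral_less_real[OF continuous_on_const contG, of 0] pos c by auto
  also have "\<dots> \<le> integral {0<..<q} G"
  proof (rule integral_subset_le)
    show "G integrable_on {c/2..c}"
      using contG by (rule integrable_continuous_real)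
    show "\<forall>u\<in>{0<..<q}. 0 \<le> G u"
      using cos_pos_quarter folded_bracket_nonneg[where n=0]
      by (force simp: G_def intro!: mult_nonneg_nonneg)
  qed (use c G in auto)
  also have "\<dots> = integral {0..4 * q} h"
    using G by (rule integral_unique)
  finally show ?thesis .
qed

end

end

section \<open>Integrability up to a finite bound and the Cauchy criterion\<close>

text \<open>Nonnegativity upgrades integrability of \<open>f\<close> near 0 to absolute
  integrability, which survives multiplication by the bounded measurable cosine.\<close>

lemma cos_mult_integrable:
  fixes f :: "real \<Rightarrow> real"
  assumes nonneg: "\<And>t. t > 0 \<Longrightarrow> f t \<ge> 0"
    and cont: "continuous_on {0<..} f"
    and int01: "f integrable_on {0<..1}"
    and "R > 0"
  shows "(\<lambda>t. f t * cos (x * t)) integrable_on {0..R}"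
proof -
  \<comment> \<open>The maximum with 1 lets \<open>{0<..1}\<close> and \<open>{1..M}\<close> be
    joined; the surplus beyond \<open>R\<close> is cut off at the end.\<close>
  define M where "M = max 1 R"
  have "f integrable_on {1..M}"
    using cont by (intro integrable_continuous_real) (auto elim: continuous_on_subset)
  then have "f integrable_on {0<..M}"
    by (rule integrable_Un'[OF int01]) (auto simp: M_def intro: negligible_subset[of "{1}"])
  then have "f absolutely_integrable_on {0<..M}"
    using nonneg by (intro nonnegative_absolutely_integrable_1) auto
  then have "(\<lambda>t. cos (x * t) * f t) absolutely_integrable_on {0<..M}"
    by (intro absolutely_integrable_bounded_measurable_product_real)
       (auto intro!: continuous_imp_measurable_on_sets_lebesgue continuous_intros boundedI[of _ 1])
  then have "(\<lambda>t. f t * cos (x * t)) integrable_on {0<..M}"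
    by (simp add: mult.commute set_lebesgue_integral_eq_integral)
  then have "(\<lambda>t. f t * cos (x * t)) integrable_on {0..M}"
    by (rule integrable_spike_set) (auto intro: negligible_subset[of "{0}"])
  then show ?thesis
    by (rule integrable_subinterval_real) (use \<open>R > 0\<close> in \<open>auto simp: M_def\<close>)
qed

lemma real_cauchy_at_top_converges:
  fixes F :: "real \<Rightarrow> real"
  assumes "\<And>e. e > 0 \<Longrightarrow> \<exists>N. \<forall>a b. N \<le> a \<and> a \<le> b \<longrightarrow> \<bar>F b - F a\<bar> < e"
  shows "\<exists>L. (F \<longlongrightarrow> L) at_top"
proof -
  have "cauchy_filter (filtermap F at_top)"
    unfolding cauchy_filter_metric_filtermap
  proof (intro allI impI)
    fix e :: real
    assume "e > 0"
    then obtain N where "\<forall>a b. N \<le> a \<and> a \<le> b \<longrightarrow> \<bar>F b - F a\<bar> < e"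
      using assms by blast
    then have "dist (F a) (F b) < e" if "N \<le> a" "N \<le> b" for a b
      using that by (cases a b rule: linorder_le_cases) (metis dist_real_def dist_commute)+
    then show "\<exists>P. eventually P at_top \<and> (\<forall>a b. P a \<and> P b \<longrightarrow> dist (F a) (F b) < e)"
      using eventually_ge_at_top[of N] by blast
  qed
  moreover have "filtermap F at_top \<noteq> bot"
    by (simp add: filtermap_bot_iff)
  ultimately show ?thesis
    using cauchy_filter_complete_converges[of "filtermap F at_top" UNIV]
    by (auto simp: filterlim_def complete_UNIV)
qed

section \<open>Convergence and positivity of the improper integral\<close>

theorem corollary4p1:
  fixes f :: "real \<Rightarrow> real"
  assumes nonneg: "\<And>t. t > 0 \<Longrightarrow> f t \<ge> 0"
    and nontrivial: "support_on {0<..} f \<noteq> {}"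
    and smooth: "sectionally_smooth_on {0<..} f"
    and cont: "continuous_on {0<..} f"
    and decr: "strict_antimono_on (support_on {0<..} f) f"
    and conv: "strictly_convex_on (support_on {0<..} f) f"
    and int01: "f integrable_on {0<..1}"
    and lim0: "(f \<longlongrightarrow> 0) at_top"
  shows "\<forall>x>0. \<exists>L>0. has_improper_integral (\<lambda>t. f t * cos (x * t)) L"
proof (intro allI impI)
  fix x :: real
  assume x: "x > 0"
  define q where "q = pi / (2 * x)"
  define h where "h = (\<lambda>t. f t * cos (x * t))"
  define F where "F = (\<lambda>R. integral {0..R} h)"
  have q: "q > 0"
    using x by (simp add: q_def)
  note anti = antimono_on_positive[OF nonneg cont decr conv]
  have int: "h integrable_on {0..R}" if "R > 0" for R
    unfolding h_def using nonneg cont int01 that by (rule cos_mult_integrable)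
  have F_diff: "F b - F a = integral {a..b} h" if "0 < a" "a \<le> b" for a b
    using Henstock_Kurzweil_Integration.integral_combine[of 0 a b h] int[of b] that by (simp add: F_def)
  have "\<exists>L. (F \<longlongrightarrow> L) at_top"
  proof (rule real_cauchy_at_top_converges)
    fix e :: real
    assume "e > 0"
    \<comment> \<open>The threshold turns the tail bound \<open>4 * f a / x\<close> into
      \<open>e\<close>.\<close>
    then have "eventually (\<lambda>t. f t < e * x / 4) at_top"
      using x by (intro order_tendstoD(2)[OF lim0]) simp
    then obtain N where N: "f t < e * x / 4" if "t \<ge> N" for t
      by (auto simp: eventually_at_top_linorder)
    \<comment> \<open>The maximum with 1 keeps \<open>a\<close> positive, where \<open>f\<close> is
      known to decrease.\<close>
    have "\<bar>F b - F a\<bar> < e" if "max 1 N \<le> a" "a \<le> b" for a b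
    proof -
      have "F b - F a = integral {a..b} (\<lambda>t. f t * cos (x * t))"
        using F_diff[of a b] that by (simp add: h_def)
      then have "\<bar>F b - F a\<bar> = \<bar>integral {a..b} (\<lambda>t. f t * cos (x * t))\<bar>"
        by simp
      also have "\<dots> \<le> 4 * f a / x"
        using that x nonneg by (intro second_mean_value_cos_bound monotone_on_subset[OF anti]) auto
      also have "\<dots> < e"
        using N[of a] that x by (simp add: field_simps)
      finally show ?thesis .
    qed
    then show "\<exists>N. \<forall>a b. N \<le> a \<and> a \<le> b \<longrightarrow> \<bar>F b - F a\<bar> < e"
      by blast
  qed
  then obtain L where L: "(F \<longlongrightarrow> L) at_top"
    by blast
  \<comment> \<open>Every period after the first adds a nonnegative amount. Passing to the limit
    along period ends keeps \<open>F (4 * q)\<close> as a lower bound for \<open>L\<close>, so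
    strict positivity need only come from the first period.\<close>
  have "F (4 * q) \<le> F (4 * q * Suc n)" for n
  proof (induction n)
    case (Suc n)
    have "h integrable_on {4 * q * Suc n..4 * q * Suc n + 4 * q}"
      using int[of "4 * q * Suc n + 4 * q"] q
      by (rule_tac integrable_subinterval_real) (auto simp: add_pos_pos)
    then have "0 \<le> integral {4 * q * Suc n..4 * q * Suc n + 4 * q} h"
      using period_integral_nonneg[OF nonneg cont decr conv x, of "Suc n"] unfolding h_def q_def by simp
    also have "\<dots> = F (4 * q * Suc n + 4 * q) - F (4 * q * Suc n)"
      using q by (intro F_diff[symmetric]) auto
    finally show ?case
      using Suc by (simp add: algebra_simps)
  qed simp
  moreover have "(\<lambda>n. F (4 * q * Suc n)) \<longlonglongrightarrow> L"
  proof (rule filterlim_compose[OF L])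
    show "filterlim (\<lambda>n. 4 * q * real (Suc n)) at_top sequentially"
      using q by (intro filterlim_tendsto_pos_mult_at_top[OF tendsto_const]
          filterlim_compose[OF filterlim_real_sequentially filterlim_Suc]) auto
  qed
  ultimately have "F (4 * q) \<le> L"
    by (intro LIMSEQ_le_const) auto
  moreover have "0 < F (4 * q)"
    unfolding F_def h_def q_def
    using int[of "4 * q"] q nontrivial
    by (intro first_period_integral_pos[OF nonneg cont decr conv x]) (auto simp: h_def q_def)
  moreover have "has_improper_integral h L"
    unfolding has_improper_integral_def
  proof (intro conjI allI impI)
    \<comment> \<open>\<open>F\<close> integrates over the closed interval; the added point 0 is a
      null set.\<close>
    show "h integrable_on {0<..R}" if "R > 0" for R
      using int[OF that] by (rule integrable_spike_set) (auto intro: negligible_subset[of "{0}"])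
    have "F = (\<lambda>R. integral {0<..R} h)"
      unfolding F_def
      by (intro ext integral_spike_set) (auto intro: negligible_subset[of "{0}"])
    then show "((\<lambda>R. integral {0<..R} h) \<longlongrightarrow> L) at_top"
      using L by simp
  qed
  ultimately show "\<exists>L>0. has_improper_integral (\<lambda>t. f t * cos (x * t)) L"
    unfolding h_def by (intro exI[of _ L]) auto
qed

end
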